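(* For any finite incidence system $\Gamma$, there exists a finite incidence system $\Gamma'$ such that $(\operatorname{Aut}(\Gamma'),\operatorname{Aut}_I(\Gamma'))\cong(\operatorname{Aut}(\Gamma),\operatorname{Aut}_I(\Gamma))$ (i.e. there is a group isomorphism $\varphi\colon\operatorname{Aut}(\Gamma')\to\operatorname{Aut}(\Gamma)$ with $\varphi(\operatorname{Aut}_I(\Gamma'))=\operatorname{Aut}_I(\Gamma)$), and such that all flags of $\Gamma'$ have rank at most two and all elements of $\Gamma'$ have degree at least two.
   Context: An incidence system is a tuple $\Gamma=(X,\ast,t,I)$ where $X$ is a non-empty set (of elements), $I$ is a finite set (of types), $t\colon X\to I$ is a surjective map (the type function), and $\ast$ is a symmetric binary relation on $X$ (the incidence relation) such that for all $x,y\in X$, if $x\neq y$ and $x\ast y$, then $t(x)\neq t(y)$. By convention, an element is not incident to itself. $\Gamma$ is finite if $X$ is finite. The degree of $x\in X$ is $|\{y\in X\mid y\ast x\}|$. A flag of $\Gamma$ is a subset $F\subset X$ such that $x\ast y$ for all $x,y\in F$ with $x\neq y$; its rank is $|F|$. A correlation of $\Gamma$ is a permutation $f$ of $X$ such that for all $x,y\in X$: $x\ast y\Leftrightarrow f(x)\ast f(y)$, and $t(x)=t(y)\Leftrightarrow t(f(x))=t(f(y))$. An automorphism of $\Gamma$ is a correlation $f$ with $t(f(x))=t(x)$ for all $x\in X$. $\operatorname{Aut}(\Gamma)$ denotes the group of all correlations of $\Gamma$ under composition, and $\operatorname{Aut}_I(\Gamma)$ denotes its normal subgroup consisting of the automorphisms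 of $\Gamma$ (the subscript $I$ is part of the notation for type-preserving automorphisms; the type sets of $\Gamma$ and $\Gamma'$ may differ). *)

theory Defs
  imports "HOL-Algebra.Algebra"
begin

record ('a, 'i) incidence_structure =
  elems :: "'a set"
  incid :: "('a \<times> 'a) set"
  etype :: "'a \<Rightarrow> 'i"
  types :: "'i set"

(* The value of etype outside elems is irrelevant. Irreflexivity is the convention that
   an element is not incident to itself. *)
locale incidence_system =
  fixes \<Gamma> :: "('a, 'i) incidence_structure"
  assumes elems_nonempty: "elems \<Gamma> \<noteq> {}"
    and finite_types: "finite (types \<Gamma>)"
    and etype_surj: "etype \<Gamma> ` elems \<Gamma> = types \<Gamma>"
    and incid_subset: "incid \<Gamma> \<subseteq> elems \<Gamma> \<times> elems \<Gamma>"
    and incid_sym: "sym (incid \<Gamma>)"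
    and incid_irrefl: "irrefl (incid \<Gamma>)"
    and incid_etype: "\<lbrakk>x \<in> elems \<Gamma>; y \<in> elems \<Gamma>; x \<noteq> y; (x, y) \<in> incid \<Gamma>\<rbrakk>
      \<Longrightarrow> etype \<Gamma> x \<noteq> etype \<Gamma> y"

locale finite_incidence_system = incidence_system +
  assumes finite_elems: "finite (elems \<Gamma>)"

definition elem_degree :: "('a, 'i) incidence_structure \<Rightarrow> 'a \<Rightarrow> nat"
  where "elem_degree \<Gamma> x = card {y \<in> elems \<Gamma>. (y, x) \<in> incid \<Gamma>}"

(* The rank of a flag F is card F. *)
definition flag :: "('a, 'i) incidence_structure \<Rightarrow> 'a set \<Rightarrow> bool"
  where "flag \<Gamma> F \<longleftrightarrow> F \<subseteq> elems \<Gamma> \<and> (\<forall>x\<in>F. \<forall>y\<in>F. x \<noteq> y \<longrightarrow> (x, y) \<in> incid \<Gamma>)"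

(* As in Bij, permutations of elems are extensional, so that each permutation is represented
   by exactly one HOL function. *)
definition correlations :: "('a, 'i) incidence_structure \<Rightarrow> ('a \<Rightarrow> 'a) set"
  where "correlations \<Gamma> = {f \<in> Bij (elems \<Gamma>). \<forall>x\<in>elems \<Gamma>. \<forall>y\<in>elems \<Gamma>.
    ((x, y) \<in> incid \<Gamma> \<longleftrightarrow> (f x, f y) \<in> incid \<Gamma>) \<and>
    (etype \<Gamma> x = etype \<Gamma> y \<longleftrightarrow> etype \<Gamma> (f x) = etype \<Gamma> (f y))}"

definition automorphisms :: "('a, 'i) incidence_structure \<Rightarrow> ('a \<Rightarrow> 'a) set"
  where "automorphisms \<Gamma> = {f \<in> correlations \<Gamma>. \<forall>x\<in>elems \<Gamma>. etype \<Gamma> (f x) = etype \<Gamma> x}"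

definition Aut :: "('a, 'i) incidence_structure \<Rightarrow> ('a \<Rightarrow> 'a) monoid"
  where "Aut \<Gamma> = (BijGroup (elems \<Gamma>))\<lparr>carrier := correlations \<Gamma>\<rparr>"

lemma subgroup_correlations: "subgroup (correlations \<Gamma>) (BijGroup (elems \<Gamma>))"
proof -
  interpret B: group "BijGroup (elems \<Gamma>)"
    by (rule group_BijGroup)
  let ?X = "elems \<Gamma>"
  have idc: "(\<lambda>x\<in>?X. x) \<in> correlations \<Gamma>"
    by (auto simp: correlations_def id_Bij)
  show ?thesis
  proof (rule B.subgroupI)
    show "correlations \<Gamma> \<subseteq> carrier (BijGroup ?X)"
      by (auto simp: correlations_def BijGroup_def)
    show "correlations \<Gamma> \<noteq> {}"
      using idc by blast
  next
    fix f assume f: "f \<in> correlations \<Gamma>"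
    then have fB: "f \<in> Bij ?X"
      by (simp add: correlations_def)
    then have bij: "bij_betw f ?X ?X"
      by (simp add: Bij_def)
    have mem: "inv_into ?X f x \<in> ?X" "f (inv_into ?X f x) = x" if "x \<in> ?X" for x
      using bij that by (auto simp: bij_betw_def inv_into_into f_inv_into_f)
    have "restrict (inv_into ?X f) ?X \<in> correlations \<Gamma>"
      using f mem restrict_inv_into_Bij[OF fB] unfolding correlations_def by simp
    then show "inv\<^bsub>BijGroup ?X\<^esub> f \<in> correlations \<Gamma>"
      by (simp add: inv_BijGroup[OF fB])
  next
    fix f g assume fg: "f \<in> correlations \<Gamma>" "g \<in> correlations \<Gamma>"
    then have B: "f \<in> Bij ?X" "g \<in> Bij ?X"
      by (simp_all add: correlations_def)
    have "g x \<in> ?X" if "x \<in> ?X" for x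
      using Bij_imp_funcset[OF B(2)] that by auto
    then have "compose ?X f g \<in> correlations \<Gamma>"
      using fg compose_Bij[OF B] by (simp add: correlations_def compose_eq)
    then show "f \<otimes>\<^bsub>BijGroup ?X\<^esub> g \<in> correlations \<Gamma>"
      using B by (simp add: BijGroup_def)
  qed
qed

lemma group_Aut: "group (Aut \<Gamma>)"
  unfolding Aut_def
  by (rule subgroup.subgroup_is_group[OF subgroup_correlations group_BijGroup])

end

theory Submission
  imports Defs
begin

text \<open>
  Let \<open>m = |X| + 1\<close>. The system \<open>\<Gamma>'\<close> is bipartite. On one side are the elements of \<open>\<Gamma>\<close> with
  their old types and \<open>m\<close> ``rows'' of one new type; on the other side, all of a second new type,
  are the edges \<open>{x, y}\<close> of \<open>\<Gamma>\<close> and \<open>m + 1\<close> ``columns''. An edge is incident to its two ends, row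
  \<open>i\<close> to all columns \<open>j \<ge> i\<close>, and each element of \<open>\<Gamma>\<close> to all columns but the last. The old types
  have fewer than \<open>m\<close> elements, the rows are exactly \<open>m\<close>, and the right side has more than \<open>m\<close>
  elements, so correlations preserve the three kinds. Rows have distinct degrees, hence are fixed;
  columns are then determined by their neighbours, the last two being told apart by the elements
  of \<open>\<Gamma>\<close>. So a correlation of \<open>\<Gamma>'\<close> is a permutation of \<open>X\<close> preserving edges and the type partition.
\<close>

section \<open>Correlations and isomorphisms given by restriction\<close>

lemma correlationsD:
  assumes "f \<in> correlations \<Gamma>"
  shows "bij_betw f (elems \<Gamma>) (elems \<Gamma>)" "f \<in> extensional (elems \<Gamma>)"
    and "\<And>x y. x \<in> elems \<Gamma> \<Longrightarrow> y \<in> elems \<Gamma> \<Longrightarrow> (f x, f y) \<in> incid \<Gamma> \<longleftrightarrow> (x, y) \<in> incid \<Gamma>"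
    and "\<And>x y. x \<in> elems \<Gamma> \<Longrightarrow> y \<in> elems \<Gamma> \<Longrightarrow> etype \<Gamma> (f x) = etype \<Gamma> (f y) \<longleftrightarrow> etype \<Gamma> x = etype \<Gamma> y"
    and "\<And>x. x \<in> elems \<Gamma> \<Longrightarrow> f x \<in> elems \<Gamma>"
  using assms by (auto simp: correlations_def Bij_def bij_betw_def)

lemma correlationsI:
  assumes "bij_betw f (elems \<Gamma>) (elems \<Gamma>)"
    and "\<And>x y. x \<in> elems \<Gamma> \<Longrightarrow> y \<in> elems \<Gamma> \<Longrightarrow> (f x, f y) \<in> incid \<Gamma> \<longleftrightarrow> (x, y) \<in> incid \<Gamma>"
    and "\<And>x y. x \<in> elems \<Gamma> \<Longrightarrow> y \<in> elems \<Gamma> \<Longrightarrow> etype \<Gamma> (f x) = etype \<Gamma> (f y) \<longleftrightarrow> etype \<Gamma> x = etype \<Gamma> y"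
  shows "restrict f (elems \<Gamma>) \<in> correlations \<Gamma>"
  using assms by (auto simp: correlations_def Bij_def cong: bij_betw_cong)

lemma correlations_eqI:
  assumes "f \<in> correlations \<Gamma>" "g \<in> correlations \<Gamma>" "\<And>x. x \<in> elems \<Gamma> \<Longrightarrow> f x = g x"
  shows "f = g"
  using assms correlationsD(2) extensionalityI by metis

lemma mult_Aut:
  assumes "f \<in> correlations \<Gamma>" "g \<in> correlations \<Gamma>"
  shows "f \<otimes>\<^bsub>Aut \<Gamma>\<^esub> g = compose (elems \<Gamma>) f g"
  using assms by (simp add: Aut_def BijGroup_def correlations_def)

lemma carrier_Aut [simp]: "carrier (Aut \<Gamma>) = correlations \<Gamma>"
  by (simp add: Aut_def)

lemma compose_correlations:
  assumes "f \<in> correlations \<Gamma>" "g \<in> correlations \<Gamma>"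
  shows "compose (elems \<Gamma>) f g \<in> correlations \<Gamma>"
  using group.is_monoid[OF group_Aut, of \<Gamma>] monoid.m_closed[of "Aut \<Gamma>" f g] assms
  by (simp add: mult_Aut)

text \<open>The isomorphism sends \<open>F\<close> to the correlation that it induces on the copy of
  \<open>elems \<Gamma>\<close> embedded by \<open>h\<close>. \<open>restr\<close> makes this map
  exist, \<open>ext\<close> makes it surjective, \<open>uniq\<close> injective, and
  \<open>auts\<close> matches the two subgroups. It serves both for relabelling, where
  \<open>h\<close> is a bijection, and for \<open>bip\<close>, where \<open>h\<close> is
  \<open>Point\<close>.\<close>

lemma restriction_iso:
  fixes h :: "'a \<Rightarrow> 'b" and \<Gamma> :: "('a, 'i) incidence_structure"
    and \<Delta> :: "('b, 'j) incidence_structure"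
  assumes inj: "inj_on h (elems \<Gamma>)" and into: "h ` elems \<Gamma> \<subseteq> elems \<Delta>"
    and restr: "\<And>F. F \<in> correlations \<Delta> \<Longrightarrow> \<exists>f\<in>correlations \<Gamma>. \<forall>x\<in>elems \<Gamma>. F (h x) = h (f x)"
    and ext: "\<And>f. f \<in> correlations \<Gamma> \<Longrightarrow> \<exists>F\<in>correlations \<Delta>. \<forall>x\<in>elems \<Gamma>. F (h x) = h (f x)"
    and uniq: "\<And>F G. F \<in> correlations \<Delta> \<Longrightarrow> G \<in> correlations \<Delta> \<Longrightarrow>
      \<forall>x\<in>elems \<Gamma>. F (h x) = G (h x) \<Longrightarrow> F = G"
    and auts: "\<And>F f. F \<in> correlations \<Delta> \<Longrightarrow> f \<in> correlations \<Gamma> \<Longrightarrow>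
      \<forall>x\<in>elems \<Gamma>. F (h x) = h (f x) \<Longrightarrow> F \<in> automorphisms \<Delta> \<longleftrightarrow> f \<in> automorphisms \<Gamma>"
  shows "\<exists>\<phi> \<in> iso (Aut \<Delta>) (Aut \<Gamma>). \<phi> ` automorphisms \<Delta> = automorphisms \<Gamma>"
proof -
  obtain \<phi> where \<phi>: "\<And>F. F \<in> correlations \<Delta> \<Longrightarrow> \<phi> F \<in> correlations \<Gamma>"
    "\<And>F x. F \<in> correlations \<Delta> \<Longrightarrow> x \<in> elems \<Gamma> \<Longrightarrow> F (h x) = h (\<phi> F x)"
    using restr by metis
  \<comment> \<open>As \<open>h\<close> is injective, \<open>F\<close> induces only one correlation
    of \<Gamma>, so any \<open>f\<close> that fits equals the chosen \<open>\<phi> F\<close>.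
    Multiplicativity and surjectivity both follow from this.\<close>
  have \<phi>_eq: "\<phi> F = f" if F: "F \<in> correlations \<Delta>" and f: "f \<in> correlations \<Gamma>"
    and eq: "\<And>x. x \<in> elems \<Gamma> \<Longrightarrow> F (h x) = h (f x)" for F f
  proof (rule correlations_eqI[OF \<phi>(1)[OF F] f])
    fix x assume x: "x \<in> elems \<Gamma>"
    have "h (\<phi> F x) = h (f x)"
      using \<phi>(2)[OF F x] eq[OF x] by simp
    then show "\<phi> F x = f x"
      using inj correlationsD(5)[OF \<phi>(1)[OF F] x] correlationsD(5)[OF f x] by (meson inj_onD)
  qed
  have hom: "\<phi> (compose (elems \<Delta>) F G) = compose (elems \<Gamma>) (\<phi> F) (\<phi> G)"
    if F: "F \<in> correlations \<Delta>" and G: "G \<in> correlations \<Delta>" for F G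
  proof (rule \<phi>_eq)
    fix x assume x: "x \<in> elems \<Gamma>"
    then have "h x \<in> elems \<Delta>"
      using into by auto
    then show "compose (elems \<Delta>) F G (h x) = h (compose (elems \<Gamma>) (\<phi> F) (\<phi> G) x)"
      using x \<phi>(2)[OF F] \<phi>(2)[OF G x] correlationsD(5)[OF \<phi>(1)[OF G] x]
      by (simp add: compose_eq)
  qed (use F G \<phi>(1) in \<open>auto intro: compose_correlations\<close>)
  have surj: "\<exists>F\<in>correlations \<Delta>. \<phi> F = f \<and> (F \<in> automorphisms \<Delta> \<longleftrightarrow> f \<in> automorphisms \<Gamma>)"
    if "f \<in> correlations \<Gamma>" for f
    using ext[OF that] \<phi>_eq auts that by metis
  have "inj_on \<phi> (correlations \<Delta>)"
  proof (rule inj_onI)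
    fix F G assume "F \<in> correlations \<Delta>" "G \<in> correlations \<Delta>" "\<phi> F = \<phi> G"
    then show "F = G"
      using \<phi>(2)[of F] \<phi>(2)[of G] by (intro uniq) auto
  qed
  moreover have "\<phi> ` correlations \<Delta> = correlations \<Gamma>"
    using surj \<phi>(1) by blast
  ultimately have "\<phi> \<in> iso (Aut \<Delta>) (Aut \<Gamma>)"
    using \<phi>(1) hom by (auto simp: iso_def hom_def bij_betw_def mult_Aut)
  moreover have "\<phi> ` automorphisms \<Delta> = automorphisms \<Gamma>"
  proof
    show "\<phi> ` automorphisms \<Delta> \<subseteq> automorphisms \<Gamma>"
    proof
      fix f assume "f \<in> \<phi> ` automorphisms \<Delta>"
      then obtain F where F: "F \<in> automorphisms \<Delta>" "f = \<phi> F" by blast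
      then have "F \<in> correlations \<Delta>"
        by (simp add: automorphisms_def)
      then show "f \<in> automorphisms \<Gamma>"
        using auts[of F "\<phi> F"] \<phi> F by blast
    qed
    show "automorphisms \<Gamma> \<subseteq> \<phi> ` automorphisms \<Delta>"
      using surj by (force simp: automorphisms_def[of \<Gamma>])
  qed
  ultimately show ?thesis by blast
qed

section \<open>Relabelling by natural numbers\<close>

text \<open>Conjugation by \<open>h\<close> carries correlations of one system to those of the
  other. Types of \<Gamma> and \<Delta> are never compared with each other: correlations and
  automorphisms depend only on the partition of the elements into types, which \<open>h\<close>
  preserves.\<close>

lemma relabelling_iso:
  assumes h: "bij_betw h (elems \<Gamma>) (elems \<Delta>)"
    and incid: "\<And>x y. x \<in> elems \<Gamma> \<Longrightarrow> y \<in> elems \<Gamma> \<Longrightarrow> (h x, h y) \<in> incid \<Delta> \<longleftrightarrow> (x, y) \<in> incid \<Gamma>"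
    and etype: "\<And>x y. x \<in> elems \<Gamma> \<Longrightarrow> y \<in> elems \<Gamma> \<Longrightarrow>
      etype \<Delta> (h x) = etype \<Delta> (h y) \<longleftrightarrow> etype \<Gamma> x = etype \<Gamma> y"
  shows "\<exists>\<phi> \<in> iso (Aut \<Delta>) (Aut \<Gamma>). \<phi> ` automorphisms \<Delta> = automorphisms \<Gamma>"
proof (rule restriction_iso)
  define k where "k = inv_into (elems \<Gamma>) h"
  have hk: "h x \<in> elems \<Delta>" "k (h x) = x" if "x \<in> elems \<Gamma>" for x
    using h that by (auto simp: k_def bij_betw_def)
  have kh: "k y \<in> elems \<Gamma>" "h (k y) = y" if "y \<in> elems \<Delta>" for y
    using h that by (auto simp: k_def bij_betw_def inv_into_into f_inv_into_f)
  have bk: "bij_betw k (elems \<Delta>) (elems \<Gamma>)"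
    unfolding k_def using h by (rule bij_betw_inv_into)
  show "inj_on h (elems \<Gamma>)" "h ` elems \<Gamma> \<subseteq> elems \<Delta>"
    using h by (auto simp: bij_betw_def)
  show "\<exists>f\<in>correlations \<Gamma>. \<forall>x\<in>elems \<Gamma>. F (h x) = h (f x)" if F: "F \<in> correlations \<Delta>" for F
  proof (rule bexI)
    note D = correlationsD[OF F]
    have "bij_betw (k \<circ> (F \<circ> h)) (elems \<Gamma>) (elems \<Gamma>)"
      using h D(1) bk by (blast intro: bij_betw_trans)
    then show "restrict (k \<circ> (F \<circ> h)) (elems \<Gamma>) \<in> correlations \<Gamma>"
    proof (rule correlationsI)
      fix x y assume "x \<in> elems \<Gamma>" "y \<in> elems \<Gamma>"
      then show "((k \<circ> (F \<circ> h)) x, (k \<circ> (F \<circ> h)) y) \<in> incid \<Gamma> \<longleftrightarrow> (x, y) \<in> incid \<Gamma>"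
        "etype \<Gamma> ((k \<circ> (F \<circ> h)) x) = etype \<Gamma> ((k \<circ> (F \<circ> h)) y) \<longleftrightarrow> etype \<Gamma> x = etype \<Gamma> y"
        by (simp_all add: incid[symmetric] etype[symmetric] D hk kh)
    qed
    show "\<forall>x\<in>elems \<Gamma>. F (h x) = h (restrict (k \<circ> (F \<circ> h)) (elems \<Gamma>) x)"
      by (simp add: D hk kh)
  qed
  show "\<exists>F\<in>correlations \<Delta>. \<forall>x\<in>elems \<Gamma>. F (h x) = h (f x)" if f: "f \<in> correlations \<Gamma>" for f
  proof (rule bexI)
    note D = correlationsD[OF f]
    have "bij_betw (h \<circ> (f \<circ> k)) (elems \<Delta>) (elems \<Delta>)"
      using h D(1) bk by (blast intro: bij_betw_trans)
    then show "restrict (h \<circ> (f \<circ> k)) (elems \<Delta>) \<in> correlations \<Delta>"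
    proof (rule correlationsI)
      fix x y assume xy: "x \<in> elems \<Delta>" "y \<in> elems \<Delta>"
      show "((h \<circ> (f \<circ> k)) x, (h \<circ> (f \<circ> k)) y) \<in> incid \<Delta> \<longleftrightarrow> (x, y) \<in> incid \<Delta>"
        using xy incid[of "k x" "k y"] by (simp add: incid D kh)
      show "etype \<Delta> ((h \<circ> (f \<circ> k)) x) = etype \<Delta> ((h \<circ> (f \<circ> k)) y) \<longleftrightarrow> etype \<Delta> x = etype \<Delta> y"
        using xy etype[of "k x" "k y"] by (simp add: etype D kh)
    qed
    show "\<forall>x\<in>elems \<Gamma>. restrict (h \<circ> (f \<circ> k)) (elems \<Delta>) (h x) = h (f x)"
      by (simp add: D hk kh)
  qed
  show "F = G" if FG: "F \<in> correlations \<Delta>" "G \<in> correlations \<Delta>"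
    "\<forall>x\<in>elems \<Gamma>. F (h x) = G (h x)" for F G
    using FG(1,2) by (rule correlations_eqI) (metis FG(3) kh)
  show "F \<in> automorphisms \<Delta> \<longleftrightarrow> f \<in> automorphisms \<Gamma>"
    if F: "F \<in> correlations \<Delta>" and f: "f \<in> correlations \<Gamma>"
      and eq: "\<forall>x\<in>elems \<Gamma>. F (h x) = h (f x)" for F f
  proof -
    \<comment> \<open>Every element of \<Delta> is some \<open>h x\<close>, so type preservation by
      \<open>F\<close> can be tested on the image of \<open>h\<close> and then read off in
      \<Gamma>.\<close>
    have "(\<forall>y\<in>elems \<Delta>. etype \<Delta> (F y) = etype \<Delta> y) \<longleftrightarrow>
      (\<forall>x\<in>elems \<Gamma>. etype \<Delta> (F (h x)) = etype \<Delta> (h x))"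
      using hk kh by metis
    also have "\<dots> \<longleftrightarrow> (\<forall>x\<in>elems \<Gamma>. etype \<Gamma> (f x) = etype \<Gamma> x)"
      using eq etype correlationsD(5)[OF f] by simp
    finally show ?thesis
      using F f by (simp add: automorphisms_def)
  qed
qed

text \<open>The goal asks for a system over \<open>nat\<close>, whereas the construction below lives
  on a datatype over \<open>'a\<close>. Finiteness lets elements and types be numbered by two
  independent injections.\<close>

lemma ex_nat_relabelling:
  fixes \<Gamma> :: "('a, 'i) incidence_structure"
  assumes "finite_incidence_system \<Gamma>"
  obtains \<Delta> :: "(nat, nat) incidence_structure" and h where
    "finite_incidence_system \<Delta>" "bij_betw h (elems \<Gamma>) (elems \<Delta>)"
    "\<And>x y. x \<in> elems \<Gamma> \<Longrightarrow> y \<in> elems \<Gamma> \<Longrightarrow> (h x, h y) \<in> incid \<Delta> \<longleftrightarrow> (x, y) \<in> incid \<Gamma>"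
    "\<And>x y. x \<in> elems \<Gamma> \<Longrightarrow> y \<in> elems \<Gamma> \<Longrightarrow>
      etype \<Delta> (h x) = etype \<Delta> (h y) \<longleftrightarrow> etype \<Gamma> x = etype \<Gamma> y"
proof -
  interpret finite_incidence_system \<Gamma> by fact
  obtain h :: "'a \<Rightarrow> nat" where h: "inj_on h (elems \<Gamma>)"
    using finite_imp_inj_to_nat_seg[OF finite_elems] by auto
  obtain g :: "'i \<Rightarrow> nat" where g: "inj_on g (types \<Gamma>)"
    using finite_imp_inj_to_nat_seg[OF finite_types] by auto
  define \<Delta> :: "(nat, nat) incidence_structure" where
    "\<Delta> = \<lparr>elems = h ` elems \<Gamma>, incid = map_prod h h ` incid \<Gamma>,
      etype = (\<lambda>y. g (etype \<Gamma> (inv_into (elems \<Gamma>) h y))), types = g ` types \<Gamma>\<rparr>"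
  have [simp]: "inv_into (elems \<Gamma>) h (h x) = x" if "x \<in> elems \<Gamma>" for x
    using h that by simp
  have incid: "(h x, h y) \<in> incid \<Delta> \<longleftrightarrow> (x, y) \<in> incid \<Gamma>"
    if "x \<in> elems \<Gamma>" "y \<in> elems \<Gamma>" for x y
  proof -
    have "map_prod h h (x, y) \<in> map_prod h h ` incid \<Gamma> \<longleftrightarrow> (x, y) \<in> incid \<Gamma>"
      using map_prod_inj_on[OF h h] incid_subset that by (intro inj_on_image_mem_iff) auto
    then show ?thesis
      by (simp add: \<Delta>_def)
  qed
  have etype: "etype \<Delta> (h x) = etype \<Delta> (h y) \<longleftrightarrow> etype \<Gamma> x = etype \<Gamma> y"
    if "x \<in> elems \<Gamma>" "y \<in> elems \<Gamma>" for x y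
    using that inj_on_eq_iff[OF g] etype_surj by (auto simp: \<Delta>_def)
  have elems: "elems \<Delta> = h ` elems \<Gamma>"
    by (simp add: \<Delta>_def)
  have "finite_incidence_system \<Delta>"
  proof
    show "elems \<Delta> \<noteq> {}" "finite (elems \<Delta>)" "finite (types \<Delta>)"
      using elems_nonempty finite_elems finite_types by (simp_all add: \<Delta>_def)
    show "etype \<Delta> ` elems \<Delta> = types \<Delta>"
      using etype_surj[symmetric] by (simp add: \<Delta>_def image_image cong: image_cong)
    show sub: "incid \<Delta> \<subseteq> elems \<Delta> \<times> elems \<Delta>"
      using incid_subset by (auto simp: \<Delta>_def)
    show "sym (incid \<Delta>)"
      using symD[OF incid_sym] by (intro symI) (auto simp: \<Delta>_def)
    show "irrefl (incid \<Delta>)"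
    proof (rule irreflI)
      fix y show "(y, y) \<notin> incid \<Delta>"
      proof
        assume y: "(y, y) \<in> incid \<Delta>"
        then have "y \<in> h ` elems \<Gamma>"
          using sub elems by auto
        then obtain x where x: "x \<in> elems \<Gamma>" "y = h x"
          by blast
        then show False
          using y incid[OF x(1) x(1)] incid_irrefl by (simp add: irrefl_def)
      qed
    qed
    show "etype \<Delta> x \<noteq> etype \<Delta> y"
      if "x \<in> elems \<Delta>" "y \<in> elems \<Delta>" "x \<noteq> y" "(x, y) \<in> incid \<Delta>" for x y
    proof -
      obtain a b where ab: "a \<in> elems \<Gamma>" "b \<in> elems \<Gamma>" "x = h a" "y = h b"
        using \<open>x \<in> elems \<Delta>\<close> \<open>y \<in> elems \<Delta>\<close> unfolding elems by (elim imageE)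
      then show ?thesis
        using that(3,4) incid[OF ab(1,2)] etype[OF ab(1,2)] incid_etype[OF ab(1,2)] ab(3,4) by blast
    qed
  qed
  moreover have "bij_betw h (elems \<Gamma>) (elems \<Delta>)"
    using h by (simp add: bij_betw_def elems)
  ultimately show thesis
    using incid etype by (rule that)
qed

section \<open>Invariants of correlations\<close>

lemma bij_betw_endo:
  assumes "finite A" "inj_on f A" "\<And>x. x \<in> A \<Longrightarrow> f x \<in> A"
  shows "bij_betw f A A"
proof -
  have "f ` A = A"
    using assms(1) _ assms(2) by (rule endo_inj_surj) (use assms(3) in blast)
  then show ?thesis
    using assms(2) by (simp add: bij_betw_def)
qed

text \<open>Common source of the two invariants used later: the size of the type class of an
  element, and its degree.\<close>

lemma card_Collect_bij_betw:
  assumes f: "bij_betw f A A" and P: "\<And>y. y \<in> A \<Longrightarrow> Q (f y) \<longleftrightarrow> P y"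
  shows "card {y \<in> A. Q y} = card {y \<in> A. P y}"
proof -
  have "f ` {y \<in> A. P y} = {y \<in> A. Q y}"
  proof
    show "{y \<in> A. Q y} \<subseteq> f ` {y \<in> A. P y}"
    proof
      fix z assume z: "z \<in> {y \<in> A. Q y}"
      then obtain y where "y \<in> A" "z = f y"
        using f by (auto simp: bij_betw_def)
      then show "z \<in> f ` {y \<in> A. P y}"
        using z P by blast
    qed
  qed (use f P in \<open>auto simp: bij_betw_def\<close>)
  then have "card {y \<in> A. Q y} = card (f ` {y \<in> A. P y})"
    by simp
  also have "\<dots> = card {y \<in> A. P y}"
    by (rule card_image[OF inj_on_subset[OF bij_betw_imp_inj_on[OF f]]]) auto
  finally show ?thesis .
qed

lemma card_etype_correlation:
  assumes f: "f \<in> correlations \<Gamma>" and x: "x \<in> elems \<Gamma>"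
  shows "card {y \<in> elems \<Gamma>. etype \<Gamma> y = etype \<Gamma> (f x)} = card {y \<in> elems \<Gamma>. etype \<Gamma> y = etype \<Gamma> x}"
  using correlationsD(1)[OF f] correlationsD(4)[OF f _ x] by (rule card_Collect_bij_betw)

lemma elem_degree_correlation:
  assumes f: "f \<in> correlations \<Gamma>" and x: "x \<in> elems \<Gamma>"
  shows "elem_degree \<Gamma> (f x) = elem_degree \<Gamma> x"
  unfolding elem_degree_def
  using correlationsD(1)[OF f] correlationsD(3)[OF f _ x] by (rule card_Collect_bij_betw)

section \<open>The bipartite system\<close>

text \<open>\<open>Edge\<close> carries an unordered pair, so the incidences of \<open>x\<close>
  with \<open>y\<close> and of \<open>y\<close> with \<open>x\<close> give a single cell. The bounds
  on the indices of rows and columns are imposed later, by \<open>cells\<close>.\<close>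

datatype 'a cell = Point 'a | Row nat | Col nat | Edge "'a set"

datatype 'i kind = Point_type 'i | Row_type | Right_type

primrec cell_type :: "('a \<Rightarrow> 'i) \<Rightarrow> 'a cell \<Rightarrow> 'i kind" where
  "cell_type t (Point x) = Point_type (t x)"
| "cell_type t (Row i) = Row_type"
| "cell_type t (Col j) = Right_type"
| "cell_type t (Edge s) = Right_type"

text \<open>Oriented from the left side to the right side; \<open>bip\<close> symmetrises it.
  Between rows and columns it is a half graph, whose purpose is to have no nontrivial symmetry on
  the rows.\<close>

fun joins :: "nat \<Rightarrow> 'a cell \<Rightarrow> 'a cell \<Rightarrow> bool" where
  "joins m (Point x) (Col j) \<longleftrightarrow> j < m"
| "joins m (Point x) (Edge s) \<longleftrightarrow> x \<in> s"
| "joins m (Row i) (Col j) \<longleftrightarrow> i \<le> j"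
| "joins m _ _ \<longleftrightarrow> False"

primrec lift_cell :: "('a \<Rightarrow> 'b) \<Rightarrow> 'a cell \<Rightarrow> 'b cell" where
  "lift_cell f (Point x) = Point (f x)"
| "lift_cell f (Row i) = Row i"
| "lift_cell f (Col j) = Col j"
| "lift_cell f (Edge s) = Edge (f ` s)"

context finite_incidence_system
begin

definition m :: nat where "m = Suc (card (elems \<Gamma>))"

definition edges :: "'a set set" where
  "edges = {{x, y} | x y. (x, y) \<in> incid \<Gamma>}"

definition cells :: "'a cell set" where
  "cells = Point ` elems \<Gamma> \<union> Row ` {..<m} \<union> Col ` {..m} \<union> Edge ` edges"

text \<open>Taking the image of \<open>cells\<close> as the type set makes the type function
  surjective by construction.\<close>

definition bip :: "('a cell, 'b kind) incidence_structure" where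
  "bip = \<lparr>elems = cells,
    incid = {(u, v). u \<in> cells \<and> v \<in> cells \<and> (joins m u v \<or> joins m v u)},
    etype = cell_type (etype \<Gamma>), types = cell_type (etype \<Gamma>) ` cells\<rparr>"

lemma bip_simps [simp]:
  "elems bip = cells"
  "(u, v) \<in> incid bip \<longleftrightarrow> u \<in> cells \<and> v \<in> cells \<and> (joins m u v \<or> joins m v u)"
  "etype bip = cell_type (etype \<Gamma>)"
  by (auto simp: bip_def)

lemma cells_iff [simp]:
  "Point x \<in> cells \<longleftrightarrow> x \<in> elems \<Gamma>" "Row i \<in> cells \<longleftrightarrow> i < m"
  "Col j \<in> cells \<longleftrightarrow> j \<le> m" "Edge s \<in> cells \<longleftrightarrow> s \<in> edges"
  by (auto simp: cells_def)

lemma edgeE: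
  assumes "s \<in> edges"
  obtains x y where "s = {x, y}" "(x, y) \<in> incid \<Gamma>" "x \<in> elems \<Gamma>" "y \<in> elems \<Gamma>" "x \<noteq> y"
proof -
  obtain x y where xy: "s = {x, y}" "(x, y) \<in> incid \<Gamma>"
    using assms by (auto simp: edges_def)
  show thesis
  proof (rule that[OF xy])
    show "x \<in> elems \<Gamma>" "y \<in> elems \<Gamma>"
      using xy(2) incid_subset by auto
    show "x \<noteq> y"
      using xy(2) incid_irrefl by (auto simp: irrefl_def)
  qed
qed

lemma edges_subset: "s \<in> edges \<Longrightarrow> s \<subseteq> elems \<Gamma>"
  by (auto elim!: edgeE)

text \<open>The set \<open>{x, y}\<close> forgets which end came first; symmetry of incidence
  recovers the pair in either order.\<close>

lemma insert_edges_iff: "{x, y} \<in> edges \<longleftrightarrow> (x, y) \<in> incid \<Gamma>"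
  using symD[OF incid_sym] unfolding edges_def by (fastforce simp: doubleton_eq_iff)

lemma finite_cells: "finite cells"
proof -
  have "finite edges"
    using finite_elems edges_subset by (intro finite_subset[of edges "Pow (elems \<Gamma>)"]) auto
  then show ?thesis
    using finite_elems by (simp add: cells_def)
qed

text \<open>This is bipartiteness, with \<open>Right_type\<close> marking one side. The function
  \<open>t\<close> is arbitrary because the side of a cell does not depend on the old types.
  Irreflexivity, the type condition and the bound on flags all come from it.\<close>

lemma incid_bip_type:
  "(u, v) \<in> incid bip \<Longrightarrow> cell_type t u = Right_type \<longleftrightarrow> cell_type t v \<noteq> Right_type"
  by (cases u; cases v) auto

lemma finite_incidence_system_bip: "finite_incidence_system bip"
proof
  show "elems bip \<noteq> {}"
    using elems_nonempty by (auto simp: cells_def)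
  show "finite (types bip)"
    using finite_cells by (simp add: bip_def)
  show "etype bip ` elems bip = types bip"
    by (simp add: bip_def)
  show "incid bip \<subseteq> elems bip \<times> elems bip" "sym (incid bip)"
    by (auto simp: sym_def)
  show "irrefl (incid bip)"
    using incid_bip_type by (auto simp: irrefl_def simp del: bip_simps)
  show "etype bip u \<noteq> etype bip v" if "(u, v) \<in> incid bip" for u v
    using incid_bip_type[OF that, of "etype \<Gamma>"] by auto
  show "finite (elems bip)"
    by (simp add: finite_cells)
qed

text \<open>Distinct members of a flag are incident, hence on opposite sides, so the side is an
  injection of the flag into \<open>bool\<close>.\<close>

lemma flag_bip:
  assumes "flag bip F"
  shows "card F \<le> 2"
proof -
  have "inj_on (\<lambda>u. cell_type (etype \<Gamma>) u = Right_type) F"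
    using assms incid_bip_type unfolding flag_def inj_on_def by blast
  then have "card F \<le> card (UNIV :: bool set)"
    by (rule card_inj_on_le) auto
  then show ?thesis by simp
qed

lemma m_ge_2: "m \<ge> 2"
  using elems_nonempty finite_elems by (simp add: m_def Suc_le_eq card_gt_0_iff)

text \<open>Two explicit neighbours are given for each kind of cell. Points and the last column need
  \<open>m_ge_2\<close>, so that columns 0 and 1 precede the last one and rows 0 and 1 exist; an
  edge has distinct ends because incidence is irreflexive.\<close>

lemma degree_bip:
  assumes "u \<in> cells"
  shows "elem_degree bip u \<ge> 2"
proof -
  obtain x0 where x0: "x0 \<in> elems \<Gamma>"
    using elems_nonempty by blast
  have "\<exists>v w. v \<noteq> w \<and> (v, u) \<in> incid bip \<and> (w, u) \<in> incid bip"
  proof (cases u)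
    case (Point x)
    then show ?thesis
      using assms m_ge_2 by (intro exI[of _ "Col 0"] exI[of _ "Col 1"]) auto
  next
    case (Row i)
    then show ?thesis
      using assms by (intro exI[of _ "Col i"] exI[of _ "Col m"]) auto
  next
    case (Col j)
    show ?thesis
    proof (cases "j = m")
      case True
      then show ?thesis
        using Col assms m_ge_2 by (intro exI[of _ "Row 0"] exI[of _ "Row 1"]) auto
    next
      case False
      then show ?thesis
        using Col assms x0 m_ge_2 by (intro exI[of _ "Row 0"] exI[of _ "Point x0"]) simp
    qed
  next
    case (Edge s)
    then have "s \<in> edges"
      using assms by simp
    then obtain x y where "s = {x, y}" "x \<in> elems \<Gamma>" "y \<in> elems \<Gamma>" "x \<noteq> y"
      by (rule edgeE)
    then show ?thesis
      using Edge \<open>s \<in> edges\<close> by (intro exI[of _ "Point x"] exI[of _ "Point y"]) simp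
  qed
  then obtain v w where vw: "v \<noteq> w" "(v, u) \<in> incid bip" "(w, u) \<in> incid bip"
    by blast
  then have "{v, w} \<subseteq> {y \<in> elems bip. (y, u) \<in> incid bip}"
    by auto
  then have "card {v, w} \<le> elem_degree bip u"
    unfolding elem_degree_def using finite_cells by (intro card_mono) auto
  then show ?thesis
    using vw(1) by simp
qed

section \<open>Correlations preserve the kinds of cells\<close>

lemma card_Point_type: "card {v \<in> cells. cell_type (etype \<Gamma>) v = Point_type i} < m"
proof -
  have "{v \<in> cells. cell_type (etype \<Gamma>) v = Point_type i} \<subseteq> Point ` elems \<Gamma>"
    by (auto simp: cells_def)
  then have "card {v \<in> cells. cell_type (etype \<Gamma>) v = Point_type i} \<le> card (elems \<Gamma>)"
    using finite_elems by (meson surj_card_le)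
  then show ?thesis by (simp add: m_def)
qed

lemma card_Row_type: "card {v \<in> cells. cell_type (etype \<Gamma>) v = Row_type} = m"
proof -
  have "{v \<in> cells. cell_type (etype \<Gamma>) v = Row_type} = Row ` {..<m}"
    by (auto simp: cells_def)
  then show ?thesis by (simp add: card_image inj_on_def)
qed

lemma card_Right_type: "card {v \<in> cells. cell_type (etype \<Gamma>) v = Right_type} > m"
proof -
  \<comment> \<open>The \<open>m + 1\<close> columns alone already exceed the bound, whatever the
    number of edges.\<close>
  have "card (Col ` {..m} :: 'a cell set) \<le> card {v \<in> cells. cell_type (etype \<Gamma>) v = Right_type}"
    using finite_cells by (intro card_mono) auto
  then show ?thesis by (simp add: card_image inj_on_def)
qed

text \<open>The three kinds have type classes of size below, equal to and above \<open>m\<close>, so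
  the size of the class reveals the kind.\<close>

lemma kind_iff_card:
  "k = Row_type \<longleftrightarrow> card {v \<in> cells. cell_type (etype \<Gamma>) v = k} = m"
  "k = Right_type \<longleftrightarrow> card {v \<in> cells. cell_type (etype \<Gamma>) v = k} > m"
proof (atomize (full), cases k)
  case (Point_type i)
  then show "(k = Row_type \<longleftrightarrow> card {v \<in> cells. cell_type (etype \<Gamma>) v = k} = m) \<and>
      (k = Right_type \<longleftrightarrow> card {v \<in> cells. cell_type (etype \<Gamma>) v = k} > m)"
    using card_Point_type[of i] by auto
qed (use card_Row_type card_Right_type in auto)

text \<open>A correlation maps type classes to classes of the same size. Only the two new types are
  pinned down; the old types may still be permuted, as correlations of \<Gamma> require.\<close>

lemma correlation_bip_type:
  assumes "F \<in> correlations bip" "u \<in> cells"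
  shows "cell_type (etype \<Gamma>) (F u) = Row_type \<longleftrightarrow> cell_type (etype \<Gamma>) u = Row_type"
    "cell_type (etype \<Gamma>) (F u) = Right_type \<longleftrightarrow> cell_type (etype \<Gamma>) u = Right_type"
proof -
  have "card {v \<in> cells. cell_type (etype \<Gamma>) v = cell_type (etype \<Gamma>) (F u)} =
      card {v \<in> cells. cell_type (etype \<Gamma>) v = cell_type (etype \<Gamma>) u}"
    using card_etype_correlation[OF assms(1), of u] assms(2) by simp
  then show "cell_type (etype \<Gamma>) (F u) = Row_type \<longleftrightarrow> cell_type (etype \<Gamma>) u = Row_type"
    "cell_type (etype \<Gamma>) (F u) = Right_type \<longleftrightarrow> cell_type (etype \<Gamma>) u = Right_type"
    unfolding kind_iff_card[of "cell_type (etype \<Gamma>) u"]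
      kind_iff_card[of "cell_type (etype \<Gamma>) (F u)"]
    by simp_all
qed

section \<open>Rows and columns are fixed\<close>

lemma elem_degree_Row:
  assumes "i < m"
  shows "elem_degree bip (Row i) = Suc m - i"
proof -
  have "{v \<in> cells. (v, Row i) \<in> incid bip} = Col ` {i..m}"
    using assms by (auto simp: cells_def)
  then show ?thesis
    by (simp add: elem_degree_def card_image inj_on_def del: bip_simps(2))
qed

lemma correlation_bip_Row:
  assumes "F \<in> correlations bip" "i < m"
  shows "F (Row i) = Row i"
proof -
  have "F (Row i) \<in> cells" "cell_type (etype \<Gamma>) (F (Row i)) = Row_type"
    using correlationsD(5)[OF assms(1)] correlation_bip_type(1)[OF assms(1)] assms(2) by auto
  then obtain k where "F (Row i) = Row k" "k < m"
    by (cases "F (Row i)") auto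
  then show ?thesis
    \<comment> \<open>Equal degrees give \<open>Suc m - k = Suc m - i\<close>; both indices are
      below \<open>m\<close>, so nothing is truncated and \<open>k = i\<close>.\<close>
    using elem_degree_correlation[OF assms(1), of "Row i"] assms(2) elem_degree_Row by simp
qed

lemma correlation_bip_Point:
  assumes "F \<in> correlations bip" "x \<in> elems \<Gamma>"
  obtains y where "F (Point x) = Point y" "y \<in> elems \<Gamma>"
proof -
  have "F (Point x) \<in> cells" "cell_type (etype \<Gamma>) (F (Point x)) \<noteq> Row_type"
    "cell_type (etype \<Gamma>) (F (Point x)) \<noteq> Right_type"
    using correlationsD(5)[OF assms(1)] correlation_bip_type[OF assms(1)] assms(2) by auto
  then show thesis
    using that by (cases "F (Point x)") auto
qed

text \<open>Since rows are fixed, the set of rows incident to a cell is an invariant. It separates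
  columns from edges, and almost separates columns from each other.\<close>

lemma correlation_bip_incid_Row:
  assumes "F \<in> correlations bip" "u \<in> cells" "i < m"
  shows "(Row i, F u) \<in> incid bip \<longleftrightarrow> (Row i, u) \<in> incid bip"
  using correlationsD(3)[OF assms(1), of "Row i" u] correlation_bip_Row[OF assms(1,3)] assms(2,3)
  by simp

lemma correlation_bip_Edge:
  assumes F: "F \<in> correlations bip" and s: "s \<in> edges"
  obtains s' where "F (Edge s) = Edge s'" "s' \<in> edges"
proof -
  have "F (Edge s) \<in> cells" "cell_type (etype \<Gamma>) (F (Edge s)) = Right_type"
    using correlationsD(5)[OF F] correlation_bip_type[OF F] s by auto
  \<comment> \<open>Row 0 meets every column and no edge.\<close>
  moreover have "(Row 0, F (Edge s)) \<notin> incid bip"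
    using correlation_bip_incid_Row[OF F, of "Edge s" 0] s m_ge_2 by simp
  ultimately show thesis
    using that m_ge_2 by (cases "F (Edge s)") auto
qed

lemma correlation_bip_Col:
  assumes F: "F \<in> correlations bip" and j: "j \<le> m"
  shows "F (Col j) = Col j"
proof -
  note R = correlation_bip_incid_Row[OF F, of "Col j"]
  have c: "F (Col j) \<in> cells" "cell_type (etype \<Gamma>) (F (Col j)) = Right_type"
    using correlationsD(5)[OF F] correlation_bip_type[OF F] j by auto
  moreover have "(Row 0, F (Col j)) \<in> incid bip"
    using R[of 0] j m_ge_2 by simp
  ultimately obtain k where k: "F (Col j) = Col k" "k \<le> m"
    by (cases "F (Col j)") auto
  \<comment> \<open>There is no row \<open>m\<close>, so the rows cannot tell column
    \<open>m - 1\<close> from column \<open>m\<close>.\<close>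
  have rows: "i \<le> k \<longleftrightarrow> i \<le> j" if "i < m" for i
    using R[of i] k j that by simp
  obtain x where x: "x \<in> elems \<Gamma>"
    using elems_nonempty by blast
  obtain y where y: "F (Point x) = Point y" "y \<in> elems \<Gamma>"
    using correlation_bip_Point[OF F x] .
  \<comment> \<open>A point meets exactly the columns below \<open>m\<close>, and \<open>F\<close>
    sends points to points; this separates the last column from the others.\<close>
  have "k < m \<longleftrightarrow> j < m"
    using correlationsD(3)[OF F, of "Point x" "Col j"] x y k j by simp
  then have "k = j"
    using rows[of k] rows[of j] k(2) j by auto
  then show ?thesis
    using k by simp
qed

section \<open>Correspondence between the correlations of the two systems\<close>

lemma correlation_bip_Point_fun:
  assumes F: "F \<in> correlations bip"
  obtains f where "\<And>x. x \<in> elems \<Gamma> \<Longrightarrow> F (Point x) = Point (f x)"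
    "bij_betw f (elems \<Gamma>) (elems \<Gamma>)"
proof -
  have "\<forall>x\<in>elems \<Gamma>. \<exists>y. F (Point x) = Point y \<and> y \<in> elems \<Gamma>"
    by (blast elim: correlation_bip_Point[OF F])
  then obtain f where f: "\<And>x. x \<in> elems \<Gamma> \<Longrightarrow> F (Point x) = Point (f x)"
    "\<And>x. x \<in> elems \<Gamma> \<Longrightarrow> f x \<in> elems \<Gamma>"
    by (auto dest!: bchoice)
  have inj: "inj_on f (elems \<Gamma>)"
  proof (rule inj_onI)
    fix x y assume xy: "x \<in> elems \<Gamma>" "y \<in> elems \<Gamma>" "f x = f y"
    then have "F (Point x) = F (Point y)"
      using f(1) by simp
    then have "Point x = Point y"
      using bij_betw_imp_inj_on[OF correlationsD(1)[OF F]] xy(1,2) by (elim inj_onD) auto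
    then show "x = y"
      by simp
  qed
  have "bij_betw f (elems \<Gamma>) (elems \<Gamma>)"
    using finite_elems inj f(2) by (rule bij_betw_endo)
  then show thesis
    using that f(1) by blast
qed

text \<open>The points incident to an edge are its ends, so incidence with points forces the image
  edge to have the images of the ends as its ends.\<close>

lemma correlation_bip_Edge_image:
  assumes F: "F \<in> correlations bip" and f: "\<And>x. x \<in> elems \<Gamma> \<Longrightarrow> F (Point x) = Point (f x)"
    and bij: "bij_betw f (elems \<Gamma>) (elems \<Gamma>)" and s: "s \<in> edges"
  shows "F (Edge s) = Edge (f ` s)" "f ` s \<in> edges"
proof -
  obtain s' where s': "F (Edge s) = Edge s'" "s' \<in> edges"
    using correlation_bip_Edge[OF F s] .
  have surj: "f ` elems \<Gamma> = elems \<Gamma>"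
    using bij by (simp add: bij_betw_def)
  have mem: "f x \<in> s' \<longleftrightarrow> x \<in> s" if "x \<in> elems \<Gamma>" for x
    using correlationsD(3)[OF F, of "Point x" "Edge s"] f s s' surj that by auto
  have "s' = f ` s"
  proof
    show "f ` s \<subseteq> s'"
    proof
      fix y assume "y \<in> f ` s"
      then obtain x where "x \<in> s" "y = f x"
        by blast
      then show "y \<in> s'"
        using mem subsetD[OF edges_subset[OF s]] by simp
    qed
    show "s' \<subseteq> f ` s"
    proof
      fix y assume y: "y \<in> s'"
      then have "y \<in> f ` elems \<Gamma>"
        using subsetD[OF edges_subset[OF s'(2)]] surj by simp
      then obtain x where "x \<in> elems \<Gamma>" "y = f x"
        by blast
      then show "y \<in> f ` s"
        using mem y by simp
    qed
  qed
  then show "F (Edge s) = Edge (f ` s)" "f ` s \<in> edges"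
    using s' by auto
qed

lemma correlation_bip_restrict:
  assumes F: "F \<in> correlations bip"
  shows "\<exists>f\<in>correlations \<Gamma>. \<forall>x\<in>elems \<Gamma>. F (Point x) = Point (f x)"
proof -
  obtain f where f: "\<And>x. x \<in> elems \<Gamma> \<Longrightarrow> F (Point x) = Point (f x)"
    and bij: "bij_betw f (elems \<Gamma>) (elems \<Gamma>)"
    using correlation_bip_Point_fun[OF F] by blast
  have inj: "inj_on f (elems \<Gamma>)"
    using bij by (simp add: bij_betw_def)
  have sub: "map_prod f f ` incid \<Gamma> \<subseteq> incid \<Gamma>"
  proof -
    have "(f x, f y) \<in> incid \<Gamma>" if "(x, y) \<in> incid \<Gamma>" for x y
      using that correlation_bip_Edge_image(2)[OF F f bij, of "{x, y}"] by (simp add: insert_edges_iff)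
    then show ?thesis
      by auto
  qed
  \<comment> \<open>Edges are known only to go to edges. For the converse, \<open>f\<close> acts
    injectively on the finite set \<open>incid \<Gamma>\<close>, hence surjectively, so every
    incident pair of images comes from an incident pair.\<close>
  have "inj_on (map_prod f f) (incid \<Gamma>)"
    using map_prod_inj_on[OF inj inj] incid_subset by (rule inj_on_subset)
  moreover have "finite (incid \<Gamma>)"
    using incid_subset finite_elems by (meson finite_SigmaI finite_subset)
  ultimately have surj: "map_prod f f ` incid \<Gamma> = incid \<Gamma>"
    using sub by (simp add: endo_inj_surj)
  have "restrict f (elems \<Gamma>) \<in> correlations \<Gamma>"
  proof (rule correlationsI[OF bij])
    fix x y assume xy: "x \<in> elems \<Gamma>" "y \<in> elems \<Gamma>"
    then have xy2: "(x, y) \<in> elems \<Gamma> \<times> elems \<Gamma>"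
      by simp
    show "(f x, f y) \<in> incid \<Gamma> \<longleftrightarrow> (x, y) \<in> incid \<Gamma>"
    proof
      assume "(f x, f y) \<in> incid \<Gamma>"
      then have "map_prod f f (x, y) \<in> map_prod f f ` incid \<Gamma>"
        using surj by simp
      then show "(x, y) \<in> incid \<Gamma>"
        unfolding inj_on_image_mem_iff[OF map_prod_inj_on[OF inj inj] xy2 incid_subset] .
    next
      assume "(x, y) \<in> incid \<Gamma>"
      then have "map_prod f f (x, y) \<in> incid \<Gamma>"
        using sub by blast
      then show "(f x, f y) \<in> incid \<Gamma>"
        by simp
    qed
    show "etype \<Gamma> (f x) = etype \<Gamma> (f y) \<longleftrightarrow> etype \<Gamma> x = etype \<Gamma> y"
      using correlationsD(4)[OF F, of "Point x" "Point y"] f xy by simp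
  qed
  moreover have "\<forall>x\<in>elems \<Gamma>. F (Point x) = Point (restrict f (elems \<Gamma>) x)"
    using f by simp
  ultimately show ?thesis
    by (intro bexI[of _ "restrict f (elems \<Gamma>)"])
qed

text \<open>Rows and columns are fixed, and edges follow their ends, so the action on points
  determines everything.\<close>

lemma correlation_bip_unique:
  assumes F: "F \<in> correlations bip" and G: "G \<in> correlations bip"
    and eq: "\<forall>x\<in>elems \<Gamma>. F (Point x) = G (Point x)"
  shows "F = G"
proof (rule correlations_eqI[OF F G])
  fix u assume u: "u \<in> elems bip"
  obtain f where f: "\<And>x. x \<in> elems \<Gamma> \<Longrightarrow> F (Point x) = Point (f x)"
    "bij_betw f (elems \<Gamma>) (elems \<Gamma>)"
    using correlation_bip_Point_fun[OF F] by blast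
  then have g: "\<And>x. x \<in> elems \<Gamma> \<Longrightarrow> G (Point x) = Point (f x)"
    using eq by simp
  show "F u = G u"
    using u eq correlation_bip_Row[OF F] correlation_bip_Row[OF G]
      correlation_bip_Col[OF F] correlation_bip_Col[OF G]
      correlation_bip_Edge_image(1)[OF F f] correlation_bip_Edge_image(1)[OF G g f(2)]
    by (cases u) auto
qed

text \<open>Letting \<open>f\<close> act on points and edges and fixing the rest respects
  \<open>joins\<close>: all points meet the same columns, and membership in an edge is preserved
  because \<open>f\<close> is injective.\<close>

lemma correlation_bip_extend:
  assumes f: "f \<in> correlations \<Gamma>"
  shows "restrict (lift_cell f) (elems bip) \<in> correlations bip"
proof (rule correlationsI)
  note D = correlationsD[OF f]
  have inj: "inj_on f (elems \<Gamma>)"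
    using D(1) by (simp add: bij_betw_def)
  have image_edges: "f ` s \<in> edges" if "s \<in> edges" for s
    using that
  proof (rule edgeE)
    fix x y assume "s = {x, y}" "(x, y) \<in> incid \<Gamma>" "x \<in> elems \<Gamma>" "y \<in> elems \<Gamma>"
    then show "f ` s \<in> edges"
      by (simp add: insert_edges_iff D(3))
  qed
  have mem: "f x \<in> f ` s \<longleftrightarrow> x \<in> s" if "x \<in> elems \<Gamma>" "s \<in> edges" for x s
    using inj_on_image_mem_iff[OF inj that(1) edges_subset[OF that(2)]] .
  have into: "lift_cell f u \<in> cells" if "u \<in> cells" for u
    using that by (cases u) (auto simp: D(5) image_edges)
  have inj_lift: "inj_on (lift_cell f) cells"
  proof (rule inj_onI)
    fix u v assume "u \<in> cells" "v \<in> cells" "lift_cell f u = lift_cell f v"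
    then show "u = v"
      using inj inj_on_image_eq_iff[OF inj edges_subset edges_subset]
      by (cases u; cases v) (auto dest: inj_onD)
  qed
  show "bij_betw (lift_cell f) (elems bip) (elems bip)"
    unfolding bip_simps using finite_cells inj_lift into by (rule bij_betw_endo)
  show "(lift_cell f u, lift_cell f v) \<in> incid bip \<longleftrightarrow> (u, v) \<in> incid bip"
    if "u \<in> elems bip" "v \<in> elems bip" for u v
    using that by (cases u; cases v) (auto simp: D(5) image_edges mem)
  show "etype bip (lift_cell f u) = etype bip (lift_cell f v) \<longleftrightarrow> etype bip u = etype bip v"
    if "u \<in> elems bip" "v \<in> elems bip" for u v
    using that by (cases u; cases v) (auto simp: D(4))
qed

text \<open>Types of rows and of the right side are preserved by every correlation, so only the
  types of points remain to be compared.\<close>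

lemma automorphism_bip_iff:
  assumes F: "F \<in> correlations bip" and f: "f \<in> correlations \<Gamma>"
    and eq: "\<forall>x\<in>elems \<Gamma>. F (Point x) = Point (f x)"
  shows "F \<in> automorphisms bip \<longleftrightarrow> f \<in> automorphisms \<Gamma>"
proof
  assume "F \<in> automorphisms bip"
  then show "f \<in> automorphisms \<Gamma>"
    using f eq by (auto simp: automorphisms_def dest: bspec[of cells _ "Point _"])
next
  assume a: "f \<in> automorphisms \<Gamma>"
  have "cell_type (etype \<Gamma>) (F u) = cell_type (etype \<Gamma>) u" if "u \<in> cells" for u
    using a eq that correlation_bip_type[OF F that]
    by (cases u) (auto simp: automorphisms_def)
  then show "F \<in> automorphisms bip"
    using F by (simp add: automorphisms_def)
qed

lemma bip_iso:
  "\<exists>\<phi> \<in> iso (Aut bip) (Aut \<Gamma>). \<phi> ` automorphisms bip = automorphisms \<Gamma>"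
proof (rule restriction_iso[where h = Point])
  show "\<exists>F\<in>correlations bip. \<forall>x\<in>elems \<Gamma>. F (Point x) = Point (f x)" if "f \<in> correlations \<Gamma>" for f
    using correlation_bip_extend[OF that] by (intro bexI) auto
qed (auto simp: inj_on_def correlation_bip_restrict correlation_bip_unique automorphism_bip_iff)

end

section \<open>Transfer of the construction to natural numbers\<close>

theorem theorem4p2:
  fixes \<Gamma> :: "('a, 'i) incidence_structure"
  assumes "finite_incidence_system \<Gamma>"
  shows "\<exists>\<Gamma>' :: (nat, nat) incidence_structure.
    finite_incidence_system \<Gamma>' \<and>
    (\<exists>\<phi> \<in> iso (Aut \<Gamma>') (Aut \<Gamma>). \<phi> ` automorphisms \<Gamma>' = automorphisms \<Gamma>) \<and>
    (\<forall>F. flag \<Gamma>' F \<longrightarrow> card F \<le> 2) \<and>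
    (\<forall>x \<in> elems \<Gamma>'. elem_degree \<Gamma>' x \<ge> 2)"
proof -
  interpret finite_incidence_system \<Gamma> by fact
  obtain \<Delta> :: "(nat, nat) incidence_structure" and h :: "'a cell \<Rightarrow> nat" where
    \<Delta>: "finite_incidence_system \<Delta>" and h: "bij_betw h (elems bip) (elems \<Delta>)"
    and incid: "\<And>u v. u \<in> elems bip \<Longrightarrow> v \<in> elems bip \<Longrightarrow>
      (h u, h v) \<in> incid \<Delta> \<longleftrightarrow> (u, v) \<in> incid bip"
    and etype: "\<And>u v. u \<in> elems bip \<Longrightarrow> v \<in> elems bip \<Longrightarrow>
      etype \<Delta> (h u) = etype \<Delta> (h v) \<longleftrightarrow> etype bip u = etype bip v"
    using ex_nat_relabelling[OF finite_incidence_system_bip] by metis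
  have inj: "inj_on h (elems bip)" and img: "elems \<Delta> = h ` elems bip"
    using h by (auto simp: bij_betw_def)
  obtain \<phi> where \<phi>: "\<phi> \<in> iso (Aut \<Delta>) (Aut bip)" "\<phi> ` automorphisms \<Delta> = automorphisms bip"
    using relabelling_iso[OF h incid etype] by blast
  obtain \<psi> where \<psi>: "\<psi> \<in> iso (Aut bip) (Aut \<Gamma>)" "\<psi> ` automorphisms bip = automorphisms \<Gamma>"
    using bip_iso by blast
  have "\<psi> \<circ> \<phi> \<in> iso (Aut \<Delta>) (Aut \<Gamma>)"
    using \<phi>(1) \<psi>(1) by (rule iso_set_trans)
  moreover have "(\<psi> \<circ> \<phi>) ` automorphisms \<Delta> = automorphisms \<Gamma>"
    using \<phi>(2) \<psi>(2) by (metis image_comp)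
  moreover have "card F \<le> 2" if F: "flag \<Delta> F" for F
  proof -
    \<comment> \<open>The bound on flags is proved for \<open>bip\<close>, so the flag is pulled
      back along \<open>h\<close>; injectivity keeps distinct elements distinct and preserves the
      rank.\<close>
    obtain K where K: "K \<subseteq> elems bip" "F = h ` K"
      using F img by (auto simp: flag_def subset_image_iff)
    have "flag bip K"
      unfolding flag_def
    proof (intro conjI ballI impI)
      fix u v assume uv: "u \<in> K" "v \<in> K" "u \<noteq> v"
      then have "h u \<noteq> h v"
        using inj K(1) by (meson inj_on_def subsetD)
      moreover have "h u \<in> F" "h v \<in> F"
        using uv K(2) by auto
      ultimately have "(h u, h v) \<in> incid \<Delta>"
        using F by (simp add: flag_def)
      then show "(u, v) \<in> incid bip"
        using incid[of u v] subsetD[OF K(1)] uv(1,2) by blast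
    qed (rule K)
    then have "card K \<le> 2"
      by (rule flag_bip)
    moreover have "card F = card K"
      unfolding K(2) using inj_on_subset[OF inj K(1)] by (rule card_image)
    ultimately show ?thesis by simp
  qed
  moreover have "elem_degree \<Delta> x \<ge> 2" if x: "x \<in> elems \<Delta>" for x
  proof -
    obtain u where u: "u \<in> elems bip" "x = h u"
      using x img by blast
    \<comment> \<open>Neighbourhoods correspond under \<open>h\<close>, so degrees agree with those
      in \<open>bip\<close>.\<close>
    have "{y \<in> elems \<Delta>. (y, x) \<in> incid \<Delta>} = h ` {v \<in> elems bip. (v, u) \<in> incid bip}"
      unfolding img u(2) by (auto simp: incid[OF _ u(1)] simp del: bip_simps)
    moreover have "inj_on h {v \<in> elems bip. (v, u) \<in> incid bip}"
      using inj by (rule inj_on_subset) blast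
    ultimately have "elem_degree \<Delta> x = elem_degree bip u"
      by (simp add: elem_degree_def card_image del: bip_simps)
    then show ?thesis
      using degree_bip u(1) by simp
  qed
  ultimately show ?thesis
    using \<Delta> by blast
qed

end
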